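(* Let $M$ be a finite indecomposable $\langle t\rangle$-module, where $\langle t\rangle=\{0,1,t,t^2,\dots\}$ is the free monoid on one generator (so that the directed graph $\Gamma_M$ is connected). (1) If $M$ is nilpotent, then $\Gamma_M$ is a rooted tree. (2) If $M$ is not nilpotent, then $\Gamma_M$ is obtained by attaching rooted trees (at their roots) to the vertices of a unique oriented cycle $\sigma$.
   Context: A $\langle t\rangle$-module is a pointed set $(M,* )$ with an action of the monoid $\langle t\rangle$ such that $(ab)\cdot m=a\cdot(b\cdot m)$, $1\cdot m=m$, $0\cdot m=*$; equivalently, a pointed set with a pointed self-map $t$. The zero module is $\{*\}$; $M\oplus N$ is the wedge sum (disjoint union with basepoints identified). A nonzero module is indecomposable if it is not isomorphic to $N\oplus L$ with both $N,L$ nonzero. $M$ is nilpotent if there is $n\in\mathbb{N}$ with $t^n\cdot m=*$ for all $m\in M$. The directed graph $\Gamma_M$ has vertex set $M\setminus\{*\}$ and a directed edge $m\to t\cdot m$ for each $m\ne *$ with $t\cdot m\neq *$; thus every vertex has at most one outgoing edge. Rooted trees are viewed as directed graphs with all edges oriented towards the root (and may consist of a single vertex). Oriented cycles may have any length $\ge 1$ (a loop $m\to m$ is an oriented cycle of length 1). *)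

theory Defs
  imports "Graph_Theory.Digraph_Component"
begin

section \<open>Modules over the free monoid on one generator\<close>

text \<open>The monoid with zero \<open>\<langle>t\<rangle> = {0, 1, t, t^2, \<dots>}\<close>; \<open>Pow n\<close> stands for \<open>t^n\<close>.\<close>

datatype tmonoid = Zero | Pow nat

instantiation tmonoid :: "{comm_monoid_mult, mult_zero}"
begin

definition "0 = Zero"

definition "1 = Pow 0"

fun times_tmonoid :: "tmonoid \<Rightarrow> tmonoid \<Rightarrow> tmonoid" where
  "Pow m * Pow n = Pow (m + n)"
| "Zero * b = Zero"
| "Pow m * Zero = Zero"

instance
proof
  fix a b c :: tmonoid
  show "a * b * c = a * (b * c)" by (cases a; cases b; cases c) auto
  show "a * b = b * a" by (cases a; cases b) auto
  show "1 * a = a" by (cases a) (auto simp: one_tmonoid_def)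
  show "0 * a = 0" by (simp add: zero_tmonoid_def)
  show "a * 0 = 0" by (cases a) (auto simp: zero_tmonoid_def)
qed

end

definition gen :: tmonoid where
  "gen = Pow 1"

lemma gen_power: "gen ^ n = Pow n"
  by (induction n) (auto simp: gen_def one_tmonoid_def)

record 'a tmod =
  points :: "'a set"
  base :: 'a
  act :: "tmonoid \<Rightarrow> 'a \<Rightarrow> 'a"

definition tmodule :: "'a tmod \<Rightarrow> bool" where
  "tmodule M \<longleftrightarrow>
     base M \<in> points M \<and>
     (\<forall>a. \<forall>m\<in>points M. act M a m \<in> points M) \<and>
     (\<forall>a b. \<forall>m\<in>points M. act M (a * b) m = act M a (act M b m)) \<and>
     (\<forall>m\<in>points M. act M 1 m = m) \<and>
     (\<forall>m\<in>points M. act M 0 m = base M)"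

definition zero_module :: "'a tmod \<Rightarrow> bool" where
  "zero_module M \<longleftrightarrow> points M = {base M}"

definition tmodule_iso :: "'a tmod \<Rightarrow> 'b tmod \<Rightarrow> bool" where
  "tmodule_iso M N \<longleftrightarrow>
     (\<exists>f. bij_betw f (points M) (points N) \<and> f (base M) = base N \<and>
          (\<forall>a. \<forall>m\<in>points M. f (act M a m) = act N a (f m)))"

text \<open>The wedge sum: \<open>None\<close> is the common base point, and \<open>wedge_inl\<close>, \<open>wedge_inr\<close> are the
  inclusions of the two summands.\<close>

definition wedge_inl :: "'a tmod \<Rightarrow> 'a \<Rightarrow> ('a + 'b) option" where
  "wedge_inl N x = (if x = base N then None else Some (Inl x))"

definition wedge_inr :: "'b tmod \<Rightarrow> 'b \<Rightarrow> ('a + 'b) option" where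
  "wedge_inr L y = (if y = base L then None else Some (Inr y))"

definition wedge_sum :: "'a tmod \<Rightarrow> 'b tmod \<Rightarrow> ('a + 'b) option tmod" where
  "wedge_sum N L =
     \<lparr> points = wedge_inl N ` points N \<union> wedge_inr L ` points L,
       base = None,
       act = (\<lambda>a z. case z of
                None \<Rightarrow> None
              | Some (Inl x) \<Rightarrow> wedge_inl N (act N a x)
              | Some (Inr y) \<Rightarrow> wedge_inr L (act L a y)) \<rparr>"

text \<open>It suffices to let the summands range over modules on the type of the elements of \<open>M\<close>:
  if \<open>M\<close> is isomorphic to a wedge sum of modules on any types, then both summands embed into
  \<open>M\<close> and so have isomorphic copies on the type of \<open>M\<close>.\<close>

definition indecomposable :: "'a tmod \<Rightarrow> bool" where
  "indecomposable M \<longleftrightarrow>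
     \<not> zero_module M \<and>
     \<not> (\<exists>(N :: 'a tmod) (L :: 'a tmod). tmodule N \<and> tmodule L \<and>
           \<not> zero_module N \<and> \<not> zero_module L \<and> tmodule_iso M (wedge_sum N L))"

definition nilpotent :: "'a tmod \<Rightarrow> bool" where
  "nilpotent M \<longleftrightarrow> (\<exists>n. \<forall>m\<in>points M. act M (gen ^ n) m = base M)"

definition module_graph :: "'a tmod \<Rightarrow> 'a pair_pre_digraph" where
  "module_graph M =
     \<lparr> pverts = points M - {base M},
       parcs = {(m, act M gen m) | m. m \<in> points M \<and> m \<noteq> base M \<and> act M gen m \<noteq> base M} \<rparr>"


section \<open>Rooted trees and oriented cycles\<close>

text \<open>\<^const>\<open>Digraph_Component.tree\<close> only forbids directed cycles, so it holds for every connected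
  acyclic digraph. Here the underlying undirected graph has to be a tree. In the symmetric digraph
  \<^const>\<open>mk_symmetric\<close> each undirected edge gives a closed walk of length 2, so undirected cycles are
  the cycles of length at least 3. Loops and antiparallel arcs are excluded separately.\<close>

definition oriented_tree :: "'v pair_pre_digraph \<Rightarrow> bool" where
  "oriented_tree G \<longleftrightarrow>
     pair_wf_digraph G \<and>
     (\<forall>u v. (u, v) \<in> parcs G \<longrightarrow> (v, u) \<notin> parcs G) \<and>
     Digraph_Component.connected (with_proj G) \<and>
     \<not> (\<exists>p. pre_digraph.cycle (with_proj (mk_symmetric (with_proj G))) p \<and> length p \<ge> 3)"

text \<open>An arc \<open>(u, v)\<close> of a tree is oriented towards the root \<open>r\<close> if the path from \<open>u\<close> to \<open>r\<close> in
  the underlying undirected tree starts with the edge from \<open>u\<close> to \<open>v\<close>.\<close>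

definition rooted_tree :: "'v pair_pre_digraph \<Rightarrow> 'v \<Rightarrow> bool" where
  "rooted_tree G r \<longleftrightarrow>
     oriented_tree G \<and> r \<in> pverts G \<and>
     (\<forall>u v. (u, v) \<in> parcs G \<longrightarrow>
        (\<exists>p. pre_digraph.apath (with_proj (mk_symmetric (with_proj G))) u ((u, v) # p) r))"

text \<open>A digraph that consists of a single oriented cycle. \<^const>\<open>pre_digraph.cycle\<close> allows
  cycles of any length at least 1, loops included.\<close>

definition oriented_cycle :: "'v pair_pre_digraph \<Rightarrow> bool" where
  "oriented_cycle C \<longleftrightarrow>
     (\<exists>p. pre_digraph.cycle (with_proj C) p \<and> parcs C = set p \<and> pverts C = fst ` set p)"

definition oriented_cycle_of :: "'v pair_pre_digraph \<Rightarrow> 'v pair_pre_digraph \<Rightarrow> bool" where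
  "oriented_cycle_of C G \<longleftrightarrow> subgraph (with_proj C) (with_proj G) \<and> oriented_cycle C"

text \<open>\<open>G\<close> arises from \<open>C\<close> by gluing, at every vertex \<open>v\<close> of \<open>C\<close>, a rooted tree \<open>T v\<close> along its
  root. The trees are realised inside \<open>G\<close>: they are pairwise disjoint and meet \<open>C\<close> only in their
  roots. Where nothing is attached, \<open>T v\<close> is the single vertex \<open>v\<close>.\<close>

definition attaching_trees :: "'v pair_pre_digraph \<Rightarrow> 'v pair_pre_digraph \<Rightarrow> bool" where
  "attaching_trees G C \<longleftrightarrow>
     (\<exists>T. (\<forall>v\<in>pverts C. rooted_tree (T v) v \<and> pverts (T v) \<inter> pverts C = {v}) \<and>
          (\<forall>v\<in>pverts C. \<forall>w\<in>pverts C. v \<noteq> w \<longrightarrow> pverts (T v) \<inter> pverts (T w) = {}) \<and>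
          pverts G = pverts C \<union> (\<Union>v\<in>pverts C. pverts (T v)) \<and>
          parcs G = parcs C \<union> (\<Union>v\<in>pverts C. parcs (T v)))"

end

theory Submission
  imports Defs "HOL-Combinatorics.Orbits"
begin

text \<open>
  A \<open>\<langle>t\<rangle>\<close>-module is a pointed set with a pointed self-map \<open>f\<close>, so the statement is about the
  dynamics of \<open>f\<close> on the finite set \<open>V\<close> of points other than the base point.

  Besides \<open>V\<close> being nonempty, indecomposability gives one fact. If \<open>C \<subseteq> V\<close> is nonempty and \<open>f\<close> maps each point of \<open>C\<close> into
  \<open>C\<close> or to the base point, then the set of points whose forward orbit meets \<open>C\<close> is a union of
  connected components of the graph. Together with the base point it is a wedge summand, and so is
  its complement. Hence every point of \<open>V\<close> reaches \<open>C\<close> (\<open>indecomposable_all_reach\<close>).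

  If \<open>M\<close> is nilpotent, follow any point of \<open>V\<close> until the last step before the base point. This
  gives \<open>r \<in> V\<close> with \<open>f r\<close> the base point, and \<open>C = {r}\<close> shows that every point flows into \<open>r\<close>.
  The number of steps needed to reach \<open>r\<close> decreases by one along each arc, which makes the graph a
  tree with root \<open>r\<close>: a vertex of maximal height on an undirected cycle would have two different
  neighbours that are not higher, but its image under \<open>f\<close> is the only such neighbour
  (\<open>rooted_tree_map_graph\<close>).

  If \<open>M\<close> is not nilpotent, some point never reaches the base point. As \<open>V\<close> is finite, its orbit
  contains a periodic point \<open>c\<close>, and with \<open>C\<close> the orbit of \<open>c\<close> every point flows into this cycle
  without ever meeting the base point. Sorting the points by their first point on \<open>C\<close> cuts the
  graph into the cycle and one tree for each vertex of it, by the same height argument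
  (\<open>attaching_trees_map_graph\<close>). The vertex set \<open>P\<close> of any oriented cycle satisfies \<open>f ` P = P\<close>;
  after enough steps \<open>P\<close> has moved into \<open>C\<close>, and so \<open>P = C\<close>
  (\<open>invariant_set_eq_attracting_orbit\<close>).
\<close>

section \<open>Graphs of self-maps\<close>

text \<open>The module graph, its cycle and the attached trees all arise from one self-map. They
  differ only in the vertex set \<open>W\<close> and in the set \<open>S\<close> of vertices that have an outgoing arc; for a
  rooted tree \<open>S\<close> omits the root.\<close>

definition map_graph :: "'v set \<Rightarrow> 'v set \<Rightarrow> ('v \<Rightarrow> 'v) \<Rightarrow> 'v pair_pre_digraph" where
  "map_graph W S f = \<lparr> pverts = W, parcs = (\<lambda>x. (x, f x)) ` S \<rparr>"

lemma map_graph_simps [simp]: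
  "pverts (map_graph W S f) = W"
  "parcs (map_graph W S f) = (\<lambda>x. (x, f x)) ` S"
  by (simp_all add: map_graph_def)

lemma pair_wf_map_graph:
  assumes "S \<subseteq> W" and "f ` S \<subseteq> W"
  shows "pair_wf_digraph (map_graph W S f)"
  using assms by unfold_locales auto

lemma parcs_mk_symmetric_map_graph:
  "(x, y) \<in> parcs (mk_symmetric (with_proj (map_graph W S f))) \<longleftrightarrow>
     (x \<in> S \<and> y = f x) \<or> (y \<in> S \<and> x = f y)"
  by (auto simp: parcs_mk_symmetric)


section \<open>Walks\<close>

lemma pcas_append: "pcas u (p @ q) v \<longleftrightarrow> (\<exists>w. pcas u p w \<and> pcas w q v)"
  by (induction p arbitrary: u) auto

lemma pawalk_verts_pcas: "pcas u p v \<Longrightarrow> pawalk_verts u p = u # map snd p"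
  by (induction p arbitrary: u) auto

lemma pcas_ends_exchange: "pcas u p v \<Longrightarrow> insert v (fst ` set p) = insert u (snd ` set p)"
  by (induction p arbitrary: u) auto

lemma pcas_closed_ends:
  assumes "pcas u p u" and "p \<noteq> []"
  shows "snd ` set p = fst ` set p"
proof -
  have "u \<in> fst ` set p" using assms by (cases p) auto
  moreover have "u \<in> snd ` set p"
    using assms by (cases p rule: rev_cases) (auto simp: pcas_append)
  ultimately show ?thesis using pcas_ends_exchange[OF assms(1)] by (simp add: insert_absorb)
qed

text \<open>The first and the last vertex of a closed walk agree, so the distinctness condition on its
  vertices says that the heads of its arcs are distinct.\<close>

lemma cycle_with_proj_iff:
  "pre_digraph.cycle (with_proj G) p \<longleftrightarrow>
     (\<exists>u. u \<in> pverts G \<and> set p \<subseteq> parcs G \<and> pcas u p u \<and> distinct (map snd p) \<and> p \<noteq> [])"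
  by (auto simp: pre_digraph.cycle_def pre_digraph.awalk_def cas_with_proj_eq
      awalk_verts_with_proj_eq pawalk_verts_pcas)

text \<open>In a cycle with at least three arcs, the vertices before and after any vertex \<open>x\<close> differ.
  Rotating the cycle so that it starts at \<open>x\<close> avoids a separate treatment of the place where the
  list of arcs closes up.\<close>

lemma cycle_predecessor_successor:
  assumes walk: "pcas u p u" and dist: "distinct (map snd p)" and len: "3 \<le> length p"
    and e: "(a, x) \<in> set p"
  obtains b where "(x, b) \<in> set p" and "a \<noteq> b" and "a \<in> snd ` set p"
proof -
  obtain p1 p2 where p: "p = p1 @ (a, x) # p2" using e by (meson split_list)
  have "pcas x (p2 @ p1) a" using walk by (auto simp: p pcas_append)
  moreover obtain e q where q: "p2 @ p1 = e # q" "q \<noteq> []"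
  proof (cases "p2 @ p1")
    case (Cons e q)
    moreover have "2 \<le> length (p2 @ p1)" using len by (simp add: p)
    ultimately show thesis using that[of e q] by (cases q) auto
  qed (use len in \<open>auto simp: p\<close>)
  ultimately have e: "fst e = x" and rest: "pcas (snd e) q a" by auto
  have "a \<in> snd ` set q"
    using rest q(2) by (cases q rule: rev_cases) (auto simp: pcas_append)
  moreover have "distinct (map snd (p2 @ p1))" using dist by (auto simp: p)
  then have "snd e \<notin> snd ` set q" unfolding q by simp
  ultimately have "a \<noteq> snd e" by metis
  moreover have sub: "set (e # q) \<subseteq> set p" unfolding q(1)[symmetric] by (auto simp: p)
  ultimately show thesis
    using that[of "snd e"] e \<open>a \<in> snd ` set q\<close> by (cases e) auto
qed


section \<open>Rooted trees\<close>

text \<open>A height that strictly decreases along the arcs leaves no room for undirected cycles: at a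
  vertex of maximal height both neighbours on the cycle would be the image under \<open>f\<close>. The same
  height shows that iterating \<open>f\<close> climbs to the root along a path without repetitions.\<close>

lemma rooted_tree_map_graph:
  fixes h :: "'v \<Rightarrow> nat"
  assumes r: "r \<in> W"
    and step: "\<And>x. x \<in> W \<Longrightarrow> x \<noteq> r \<Longrightarrow> f x \<in> W \<and> h (f x) < h x"
  shows "rooted_tree (map_graph W (W - {r}) f) r"
proof -
  define T where "T = map_graph W (W - {r}) f"
  define S where "S = mk_symmetric (with_proj T)"
  interpret T: pair_wf_digraph T
    unfolding T_def by (rule pair_wf_map_graph) (use step in auto)
  interpret S: pair_wf_digraph S
    unfolding S_def by (rule T.wellformed_mk_symmetric)
  have arc_S: "(x, y) \<in> parcs S \<longleftrightarrow> (x \<in> W - {r} \<and> y = f x) \<or> (y \<in> W - {r} \<and> x = f y)" for x y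
    unfolding S_def T_def by (rule parcs_mk_symmetric_map_graph)
  have verts_S: "pverts S = W" by (simp add: S_def T_def)

  \<comment> \<open>the height bound on the path keeps \<open>x\<close> itself from reappearing when \<open>(x, f x)\<close> is prepended\<close>
  have climb: "\<exists>p. S.apath x p r \<and> (\<forall>y\<in>set (pawalk_verts x p). h y \<le> h x) \<and>
      (x \<noteq> r \<longrightarrow> (\<exists>q. p = (x, f x) # q))" if "x \<in> W" for x
    using that
  proof (induction "h x" arbitrary: x rule: less_induct)
    case less
    show ?case
    proof (cases "x = r")
      case True
      then show ?thesis
        using r by (intro exI[of _ "[]"]) (auto simp: S.apath_Nil_iff verts_S)
    next
      case False
      then have fx: "f x \<in> W" "h (f x) < h x" using step less.prems by auto
      then obtain q where q: "S.apath (f x) q r" "\<forall>y\<in>set (pawalk_verts (f x) q). h y \<le> h (f x)"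
        using less.hyps by blast
      then have "S.apath x ((x, f x) # q) r"
        using fx False less.prems by (auto simp: S.apath_Cons_iff arc_S)
      then show ?thesis
        using q fx by (intro exI[of _ "(x, f x) # q"]) force
    qed
  qed

  have "oriented_tree T"
    unfolding oriented_tree_def S_def[symmetric]
  proof (intro conjI allI impI notI)
    show "pair_wf_digraph T" by unfold_locales
    show False if arcs: "(u, v) \<in> parcs T" "(v, u) \<in> parcs T" for u v
    proof -
      have "u \<in> W" "u \<noteq> r" "v = f u" "v \<in> W" "v \<noteq> r" "u = f v"
        using arcs by (auto simp: T_def)
      then have "h v < h u" "h u < h v" using step by metis+
      then show False by simp
    qed
    show "Digraph_Component.connected (with_proj T)"
    proof (rule T.connectedI)
      show "pverts T \<noteq> {}" using r by (auto simp: T_def)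
      fix u v assume uv: "u \<in> pverts T" "v \<in> pverts T"
      have root: "x \<rightarrow>\<^sup>*\<^bsub>with_proj S\<^esub> r" if "x \<in> W" for x
        using climb[OF that] unfolding S.reachable_apath by blast
      have sym: "symmetric (with_proj S)" unfolding S_def by (rule symmetric_mk_symmetric)
      have "u \<rightarrow>\<^sup>*\<^bsub>with_proj S\<^esub> r" "r \<rightarrow>\<^sup>*\<^bsub>with_proj S\<^esub> v"
        using uv root symmetric_reachable[OF sym] by (auto simp: T_def)
      then show "u \<rightarrow>\<^sup>*\<^bsub>with_proj (mk_symmetric (with_proj T))\<^esub> v"
        unfolding S_def[symmetric] by (rule S.reachable_trans)
    qed
    \<comment> \<open>a highest vertex \<open>x\<close> of the cycle would have \<open>f x\<close> as both of its neighbours\<close>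
    show False if cyc: "\<exists>p. pre_digraph.cycle (with_proj S) p \<and> 3 \<le> length p"
    proof -
      obtain p u where p: "set p \<subseteq> parcs S" "pcas u p u" "distinct (map snd p)" "3 \<le> length p"
        using cyc by (auto simp: cycle_with_proj_iff)
      have "p \<noteq> []" using p(4) by auto
      then have ne: "snd ` set p \<noteq> {}" by simp
      have "Max (h ` snd ` set p) \<in> h ` snd ` set p"
        using ne by (intro Max_in) auto
      then obtain e where e: "e \<in> set p" "h (snd e) = Max (h ` snd ` set p)" by auto
      obtain a x where ax: "e = (a, x)" by (cases e)
      have top: "h y \<le> h x" if "y \<in> snd ` set p" for y
        using that e(2) by (auto simp: ax intro!: Max_ge)
      obtain b where b: "(x, b) \<in> set p" "a \<noteq> b" "a \<in> snd ` set p"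
        using cycle_predecessor_successor[OF p(2,3,4)] e(1) ax by metis
      have "h a \<le> h x" "h b \<le> h x" using top b by force+
      moreover have "(a, x) \<in> parcs S" "(x, b) \<in> parcs S" using p(1) e(1) ax b(1) by auto
      ultimately have "a = f x" "b = f x"
        using step[of a] step[of b] by (auto simp: arc_S)
      then show False using b(2) by simp
    qed
  qed
  moreover have "\<exists>p. S.apath u ((u, v) # p) r" if "(u, v) \<in> parcs T" for u v
    using that climb[of u] by (auto simp: T_def)
  ultimately show ?thesis
    using r unfolding rooted_tree_def T_def[symmetric] S_def[symmetric] by (simp add: T_def)
qed


section \<open>Oriented cycles\<close>

text \<open>The cycle lists the arcs of the orbit over one minimal period. Its heads are distinct
  because there are as many of them as points in the orbit.\<close>

lemma oriented_cycle_map_graph_orbit: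
  assumes c: "c \<in> orbit f c"
  shows "oriented_cycle (map_graph (orbit f c) (orbit f c) f)"
proof -
  define k where "k = funpow_dist1 f c c"
  define p where "p = map (\<lambda>i. ((f ^^ i) c, (f ^^ Suc i) c)) [0..<k]"
  have orb: "orbit f c = (\<lambda>i. (f ^^ i) c) ` {0..<k}"
    unfolding k_def using c by (rule orbit_conv_funpow_dist1)
  have per: "(f ^^ k) c = c" unfolding k_def using c by (rule funpow_dist1_prop)
  have walk: "pcas c (map (\<lambda>i. ((f ^^ i) c, (f ^^ Suc i) c)) [0..<n]) ((f ^^ n) c)" for n
    by (induction n) (auto simp: pcas_append)
  have set_p: "set p = (\<lambda>x. (x, f x)) ` orbit f c"
    by (auto simp: p_def orb image_image)
  have closed: "pcas c p c" using walk[of k] by (simp add: p_def per)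
  have "p \<noteq> []" by (auto simp: p_def k_def)
  then have "set (map snd p) = orbit f c"
    using pcas_closed_ends[OF closed] by (simp add: set_p image_image)
  moreover have "card (orbit f c) = k"
    unfolding orb using inj_on_funpow_dist1[OF c] by (simp add: card_image k_def)
  ultimately have "distinct (map snd p)"
    by (intro card_distinct) (simp add: p_def)
  then show ?thesis
    using closed \<open>p \<noteq> []\<close> set_p c
    by (auto simp: oriented_cycle_def cycle_with_proj_iff image_image intro!: exI[of _ p])
qed

text \<open>Since each vertex has at most one outgoing arc, an oriented cycle is determined by its vertex
  set, and the map permutes this set.\<close>

lemma oriented_cycle_of_map_graphE:
  assumes "oriented_cycle_of C (map_graph W S f)"
  obtains P where "C = map_graph P P f" and "P \<subseteq> S" and "finite P" and "P \<noteq> {}" and "f ` P = P"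
proof -
  from assms obtain p where p: "pre_digraph.cycle (with_proj C) p"
      "parcs C = set p" "pverts C = fst ` set p"
      and sub: "parcs C \<subseteq> (\<lambda>x. (x, f x)) ` S"
    unfolding oriented_cycle_of_def oriented_cycle_def subgraph_def by auto
  define P where "P = fst ` set p"
  have arcs: "set p = (\<lambda>x. (x, f x)) ` P"
    using sub by (force simp: p(2) P_def image_image)
  have "C = map_graph P P f"
    using arcs p(2,3) by (cases C) (simp add: map_graph_def image_image)
  moreover have "P \<subseteq> S" using sub by (auto simp: p(2) P_def)
  moreover have "p \<noteq> []" and closed: "snd ` set p = P"
    using p(1) pcas_closed_ends[of _ p] unfolding cycle_with_proj_iff P_def by blast+
  moreover have "f ` P = P"
    using closed unfolding arcs by (simp add: image_image)
  moreover have "finite P" "P \<noteq> {}" using \<open>p \<noteq> []\<close> by (simp_all add: P_def)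
  ultimately show thesis by (intro that)
qed


section \<open>Hitting times of self-maps\<close>

text \<open>The value is unspecified if the orbit of \<open>x\<close> never meets \<open>C\<close>; the lemmas for points
  outside \<open>C\<close> therefore assume \<open>(f ^^ n) x \<in> C\<close> for some \<open>n\<close>.\<close>

definition hitting_time :: "('v \<Rightarrow> 'v) \<Rightarrow> 'v set \<Rightarrow> 'v \<Rightarrow> nat" where
  "hitting_time f C x = (LEAST n. (f ^^ n) x \<in> C)"

lemma funpow_hitting_time: "(f ^^ n) x \<in> C \<Longrightarrow> (f ^^ hitting_time f C x) x \<in> C"
  unfolding hitting_time_def by (rule LeastI)

lemma hitting_time_eq_0: "x \<in> C \<Longrightarrow> hitting_time f C x = 0"
  by (simp add: hitting_time_def)

lemma hitting_time_step:
  assumes "(f ^^ n) x \<in> C" and "x \<notin> C"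
  shows "hitting_time f C x = Suc (hitting_time f C (f x))"
  unfolding hitting_time_def using assms by (subst Least_Suc) (auto simp: funpow_swap1)

lemma funpow_image_subset: "f ` C \<subseteq> C \<Longrightarrow> x \<in> C \<Longrightarrow> (f ^^ n) x \<in> C"
  by (induction n) auto

text \<open>A point that has entered the invariant set \<open>C\<close> stays there, so waiting times for finitely many
  points can be added up. With \<open>C\<close> the base point this yields nilpotency, with \<open>C\<close> a cycle it
  yields uniqueness of the cycle.\<close>

lemma uniform_hitting_time:
  assumes "finite P" and "f ` C \<subseteq> C" and "\<And>x. x \<in> P \<Longrightarrow> \<exists>n. (f ^^ n) x \<in> C"
  shows "\<exists>N. \<forall>x\<in>P. (f ^^ N) x \<in> C"
  using assms(1,3)
proof (induction P)
  case (insert y P)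
  then obtain N where N: "\<forall>x\<in>P. (f ^^ N) x \<in> C" by (metis insertI2)
  obtain n where n: "(f ^^ n) y \<in> C" using insert.prems by (meson insertI1)
  have "\<forall>x\<in>insert y P. (f ^^ (n + N)) x \<in> C"
  proof
    fix x assume "x \<in> insert y P"
    then consider "x = y" | "(f ^^ N) x \<in> C" using N by blast
    then show "(f ^^ (n + N)) x \<in> C"
    proof cases
      case 1
      then show ?thesis
        using funpow_image_subset[OF assms(2) n, of N] by (simp add: add.commute[of n] funpow_add)
    next
      case 2
      then show ?thesis
        using funpow_image_subset[OF assms(2), of "(f ^^ N) x" n] by (simp add: funpow_add)
    qed
  qed
  then show ?case by blast
qed simp

text \<open>An orbit that stays in a finite set repeats a value, and a repeated value is periodic.\<close>

lemma recurrent_point_exists: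
  assumes "finite V" and "\<And>n. (f ^^ n) x \<in> V"
  shows "\<exists>c\<in>V. c \<in> orbit f c"
proof -
  have "finite (range (\<lambda>n. (f ^^ n) x))"
    using assms by (auto intro: finite_subset)
  then have "\<not> inj (\<lambda>n. (f ^^ n) x)"
    using finite_imageD infinite_UNIV_nat by blast
  then obtain i j where "i \<noteq> j" "(f ^^ i) x = (f ^^ j) x"
    by (auto simp: inj_def)
  then obtain i k where k: "0 < k" "(f ^^ (k + i)) x = (f ^^ i) x"
    by (metis less_imp_add_positive nat_neq_iff add.commute)
  then have "(f ^^ i) x \<in> orbit f ((f ^^ i) x)"
    unfolding orbit_altdef by (auto simp: funpow_add intro!: exI[of _ k])
  then show ?thesis using assms(2) by blast
qed

text \<open>A set with \<open>f ` P = P\<close> is unchanged by iteration, but iterating long enough carries it into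
  the orbit of \<open>c\<close>. Conversely, the orbit of \<open>c\<close> is generated by any one of its points.\<close>

lemma invariant_set_eq_attracting_orbit:
  assumes c: "c \<in> orbit f c" and P: "finite P" "P \<noteq> {}" "f ` P = P"
    and reach: "\<And>x. x \<in> P \<Longrightarrow> \<exists>n. (f ^^ n) x \<in> orbit f c"
  shows "P = orbit f c"
proof
  have closed: "f ` orbit f c \<subseteq> orbit f c" by (auto intro: orbit.step)
  obtain N where N: "\<forall>x\<in>P. (f ^^ N) x \<in> orbit f c"
    using uniform_hitting_time[OF P(1) closed reach] by blast
  have "(f ^^ N) ` P = P"
  proof (induction N)
    case (Suc N)
    have "(f ^^ Suc N) ` P = f ` (f ^^ N) ` P" by (simp add: image_comp)
    then show ?case using Suc P(3) by simp
  qed simp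
  then show "P \<subseteq> orbit f c" using N by (metis image_subset_iff)
  obtain x where "x \<in> P" using P(2) by blast
  then obtain n where n: "(f ^^ n) x \<in> orbit f c" using reach by blast
  have "(f ^^ n) x \<in> P" using funpow_image_subset[of f P] P(3) \<open>x \<in> P\<close> by simp
  then have "orbit f ((f ^^ n) x) \<subseteq> P"
    using funpow_image_subset[of f P] P(3) by (auto simp: orbit_altdef)
  moreover have "orbit f ((f ^^ n) x) = orbit f c"
    using n c by (intro orbit_cyclic_eq3) (auto simp: cyclic_on_def)
  ultimately show "orbit f c \<subseteq> P" by simp
qed


section \<open>Attaching trees to an attracting set\<close>

text \<open>The tree at \<open>v \<in> C\<close> consists of the points whose first point on \<open>C\<close> is \<open>v\<close>, with the hitting
  time of \<open>C\<close> as height. Points of \<open>C\<close> are their own first point, so they are the roots, and the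
  arcs that leave them belong to \<open>C\<close>.\<close>

lemma attaching_trees_map_graph:
  assumes CV: "C \<subseteq> V" and V: "f ` V \<subseteq> V"
    and reach: "\<And>x. x \<in> V \<Longrightarrow> \<exists>n. (f ^^ n) x \<in> C"
  shows "attaching_trees (map_graph V V f) (map_graph C C f)"
proof -
  define h where "h = hitting_time f C"
  \<comment> \<open>the retraction onto \<open>C\<close>\<close>
  define \<rho> where "\<rho> x = (f ^^ h x) x" for x
  define W where "W v = {x \<in> V. \<rho> x = v}" for v
  have \<rho>_C: "\<rho> x \<in> C" if "x \<in> V" for x
    using reach[OF that] funpow_hitting_time[of _ f x C] by (auto simp: \<rho>_def h_def)
  have \<rho>_id: "\<rho> x = x" if "x \<in> C" for x
    using that by (simp add: \<rho>_def h_def hitting_time_eq_0)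
  have h_step: "h x = Suc (h (f x))" if "x \<in> V" "x \<notin> C" for x
    using reach that hitting_time_step[of _ f x C] by (auto simp: h_def)
  have \<rho>_step: "\<rho> (f x) = \<rho> x" if "x \<in> V" "x \<notin> C" for x
    by (simp add: \<rho>_def h_step[OF that] funpow_swap1)
  have inter: "W v \<inter> C = {v}" if "v \<in> C" for v
    using that CV \<rho>_id by (auto simp: W_def)
  have tree: "rooted_tree (map_graph (W v) (W v - {v}) f) v" if v: "v \<in> C" for v
  proof (rule rooted_tree_map_graph)
    show "v \<in> W v" using inter[OF v] by blast
    fix x assume "x \<in> W v" "x \<noteq> v"
    then have "x \<in> V" "x \<notin> C" "\<rho> x = v" using \<rho>_id by (auto simp: W_def)
    then show "f x \<in> W v \<and> h (f x) < h x"
      using V h_step \<rho>_step by (auto simp: W_def)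
  qed
  have "x \<in> C \<union> (\<Union>v\<in>C. W v - {v})" if "x \<in> V" for x
    using that \<rho>_C[OF that] by (cases "\<rho> x = x") (auto simp: W_def)
  then have "V \<subseteq> C \<union> (\<Union>v\<in>C. W v - {v})" by blast
  moreover have W_V: "W v \<subseteq> V" for v by (auto simp: W_def)
  ultimately have V_arcs: "V = C \<union> (\<Union>v\<in>C. W v - {v})" using CV by blast
  then have V_verts: "V = C \<union> (\<Union>v\<in>C. W v)" using CV W_V by blast
  show ?thesis
    unfolding attaching_trees_def
  proof (intro exI[of _ "\<lambda>v. map_graph (W v) (W v - {v}) f"] conjI ballI impI)
    show "pverts (map_graph (W v) (W v - {v}) f) \<inter> pverts (map_graph (W w) (W w - {w}) f) = {}"
      if "v \<noteq> w" for v w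
      using that by (auto simp: W_def)
    have "(\<lambda>x. (x, f x)) ` V = (\<lambda>x. (x, f x)) ` C \<union> (\<Union>v\<in>C. (\<lambda>x. (x, f x)) ` (W v - {v}))"
      by (subst V_arcs) (simp only: image_Un image_UN)
    then show "parcs (map_graph V V f) = parcs (map_graph C C f) \<union>
        (\<Union>v\<in>pverts (map_graph C C f). parcs (map_graph (W v) (W v - {v}) f))"
      by simp
    show "pverts (map_graph V V f) = pverts (map_graph C C f) \<union>
        (\<Union>v\<in>pverts (map_graph C C f). pverts (map_graph (W v) (W v - {v}) f))"
      using V_verts by simp
  qed (use tree inter in simp_all)
qed


section \<open>Modules as pointed self-maps\<close>

lemma tmonoid_cases: "a = 0 \<or> (\<exists>n. a = gen ^ n)"
  by (cases a) (auto simp: gen_power zero_tmonoid_def)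

lemma act_base:
  assumes "tmodule M"
  shows "act M a (base M) = base M"
proof -
  have "base M \<in> points M" and "\<forall>m\<in>points M. act M 0 m = base M"
    and "\<forall>a b. \<forall>m\<in>points M. act M (a * b) m = act M a (act M b m)"
    using assms by (auto simp: tmodule_def)
  then show ?thesis by (metis mult_zero_right)
qed

lemma act_gen_power:
  assumes "tmodule M" and "m \<in> points M"
  shows "act M (gen ^ n) m = (act M gen ^^ n) m"
  using assms by (induction n) (auto simp: tmodule_def)

lemma module_graph_eq_map_graph:
  "module_graph M =
     map_graph (points M - {base M}) {m \<in> points M - {base M}. act M gen m \<noteq> base M} (act M gen)"
  by (auto simp: module_graph_def map_graph_def)

lemma nilpotentI_funpow:
  assumes "tmodule M" and "finite (points M)"
    and "\<And>m. m \<in> points M \<Longrightarrow> \<exists>n. (act M gen ^^ n) m = base M"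
  shows "nilpotent M"
proof -
  have "\<exists>N. \<forall>m\<in>points M. (act M gen ^^ N) m \<in> {base M}"
    using assms act_base[OF assms(1)] by (intro uniform_hitting_time) auto
  then show ?thesis
    using act_gen_power[OF assms(1)] by (auto simp: nilpotent_def)
qed

lemma tmodule_restrict:
  assumes M: "tmodule M" and U: "base M \<in> U" "U \<subseteq> points M" "act M gen ` U \<subseteq> U"
  shows "tmodule (M\<lparr>points := U\<rparr>)"
proof -
  have "act M a m \<in> U" if "m \<in> U" for a m
    using tmonoid_cases[of a]
  proof (elim disjE exE)
    assume "a = 0"
    then show ?thesis using M U that by (auto simp: tmodule_def)
  next
    fix n assume "a = gen ^ n"
    then show ?thesis
      using act_gen_power[OF M, of m n] funpow_image_subset[OF U(3) that] U(2) that by auto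
  qed
  then show ?thesis using M U by (auto simp: tmodule_def subset_iff)
qed

text \<open>A set of vertices that no arc enters or leaves splits the module into the wedge sum of the
  submodules on this set and on its complement.\<close>

lemma indecomposable_saturated_subset:
  assumes M: "tmodule M" and ind: "indecomposable M"
    and U: "U \<subseteq> points M - {base M}" "U \<noteq> {}"
    and sat: "\<And>m. m \<in> points M - {base M} \<Longrightarrow> act M gen m \<noteq> base M \<Longrightarrow>
                act M gen m \<in> U \<longleftrightarrow> m \<in> U"
  shows "U = points M - {base M}"
proof (rule ccontr)
  assume proper: "U \<noteq> points M - {base M}"
  define N where "N = M\<lparr>points := insert (base M) U\<rparr>"
  define L where "L = M\<lparr>points := points M - U\<rparr>"
  note [simp] = act_base[OF M]
  have base: "base M \<in> points M" using M by (simp add: tmodule_def)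
  have act: "act M a m \<in> points M" if "m \<in> points M" for a m
    using M that by (simp add: tmodule_def)
  have "act M gen m \<in> insert (base M) U" if "m \<in> insert (base M) U" for m
    using that U(1) sat[of m] by auto
  then have N: "tmodule N"
    unfolding N_def using U(1) base by (intro tmodule_restrict M) auto
  have "act M gen m \<in> points M - U" if "m \<in> points M - U" for m
    using that U(1) base act[of m gen] sat[of m]
    by (cases "m = base M"; cases "act M gen m = base M") auto
  then have L: "tmodule L"
    unfolding L_def using U(1) base by (intro tmodule_restrict M) auto
  define F :: "'a \<Rightarrow> ('a + 'a) option"
    where "F m = (if m \<in> U then wedge_inl N m else wedge_inr L m)" for m
  have "bij_betw F (points M) (points (wedge_sum N L))"
    unfolding bij_betw_def
  proof
    show "inj_on F (points M)"
      using U by (auto simp: inj_on_def F_def wedge_inl_def wedge_inr_def N_def L_def split: if_splits)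
    show "F ` points M = points (wedge_sum N L)"
      using U base by (auto simp: F_def wedge_sum_def wedge_inl_def wedge_inr_def N_def L_def image_iff)
  qed
  moreover have "F (base M) = base (wedge_sum N L)"
    using U by (auto simp: F_def wedge_sum_def wedge_inr_def L_def)
  moreover have "F (act M a m) = act (wedge_sum N L) a (F m)" if m: "m \<in> points M" for a m
  proof -
    \<comment> \<open>the action either stays on the side of \<open>m\<close> or goes to the base point\<close>
    have "act M a m = base M \<or> (act M a m \<in> U \<longleftrightarrow> m \<in> U)"
    proof (cases "m \<in> U")
      case True
      then have "act N a m \<in> points N" using N by (auto simp: tmodule_def N_def)
      then show ?thesis using True by (auto simp: N_def)
    next
      case False
      then have "act L a m \<in> points L" using L m by (auto simp: tmodule_def L_def)
      then show ?thesis using False by (auto simp: L_def)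
    qed
    then show ?thesis
      using U by (auto simp: F_def wedge_sum_def wedge_inl_def wedge_inr_def N_def L_def)
  qed
  ultimately have "tmodule_iso M (wedge_sum N L)" unfolding tmodule_iso_def by blast
  moreover have "\<not> zero_module N" "\<not> zero_module L"
    using U proper by (auto simp: zero_module_def N_def L_def)
  ultimately show False using ind N L unfolding indecomposable_def by blast
qed

text \<open>The points whose orbit meets \<open>C\<close> form a saturated set: backwards along an arc this is clear,
  and forwards it uses that an arc from a point of \<open>C\<close> stays in \<open>C\<close>.\<close>

lemma indecomposable_all_reach:
  assumes M: "tmodule M" and ind: "indecomposable M"
    and C: "C \<subseteq> points M - {base M}" "C \<noteq> {}"
    and closed: "\<And>c. c \<in> C \<Longrightarrow> act M gen c \<noteq> base M \<Longrightarrow> act M gen c \<in> C"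
    and m: "m \<in> points M - {base M}"
  shows "\<exists>n. (act M gen ^^ n) m \<in> C"
proof -
  define f where "f = act M gen"
  define U where "U = {x \<in> points M - {base M}. \<exists>n. (f ^^ n) x \<in> C}"
  have "U = points M - {base M}"
  proof (rule indecomposable_saturated_subset[OF M ind])
    show "U \<noteq> {}" using C by (auto simp: U_def intro!: exI[of _ "0::nat"])
    fix x assume x: "x \<in> points M - {base M}" "act M gen x \<noteq> base M"
    have fx: "f x \<in> points M - {base M}" using x M by (auto simp: f_def tmodule_def)
    show "act M gen x \<in> U \<longleftrightarrow> x \<in> U"
      unfolding f_def[symmetric]
    proof
      assume "f x \<in> U"
      then obtain n where "(f ^^ n) (f x) \<in> C" by (auto simp: U_def)
      then have "(f ^^ Suc n) x \<in> C" by (simp add: funpow_swap1)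
      then show "x \<in> U" using x by (auto simp: U_def simp del: funpow.simps)
    next
      assume "x \<in> U"
      then obtain n where n: "(f ^^ n) x \<in> C" by (auto simp: U_def)
      show "f x \<in> U"
      proof (cases n)
        case 0
        then have "(f ^^ 0) (f x) \<in> C" using n closed x by (simp add: f_def)
        then show ?thesis using fx unfolding U_def by blast
      next
        case (Suc k)
        then have "(f ^^ k) (f x) \<in> C" using n by (simp add: funpow_swap1)
        then show ?thesis using fx by (auto simp: U_def)
      qed
    qed
  qed (auto simp: U_def)
  then show ?thesis using m by (auto simp: U_def f_def)
qed


section \<open>The structure theorem\<close>

text \<open>The root is the last point other than the base point on the orbit of an arbitrary vertex.
  Every other vertex reaches it, and therefore has an outgoing arc.\<close>

lemma nilpotent_indecomposable_rooted_tree: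
  assumes M: "tmodule M" and ind: "indecomposable M" and nil: "nilpotent M"
  shows "\<exists>r. rooted_tree (module_graph M) r"
proof -
  define f where "f = act M gen"
  define V where "V = points M - {base M}"
  have f_base: "(f ^^ n) (base M) = base M" for n
    by (induction n) (simp_all add: f_def act_base[OF M])
  have f_points: "f ` points M \<subseteq> points M" using M by (auto simp: f_def tmodule_def)
  have "V \<noteq> {}" using ind M by (auto simp: V_def indecomposable_def zero_module_def tmodule_def)
  then obtain m where m: "m \<in> V" by blast
  have "\<exists>n. (f ^^ n) m = base M"
    using nil m act_gen_power[OF M] by (auto simp: nilpotent_def f_def V_def)
  moreover have "(f ^^ 0) m \<noteq> base M" using m by (simp add: V_def)
  ultimately obtain k where k: "(f ^^ k) m \<noteq> base M" "(f ^^ Suc k) m = base M"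
    using ex_least_nat_less[of "\<lambda>n. (f ^^ n) m = base M"] by blast
  define r where "r = (f ^^ k) m"
  have r: "r \<in> V" "f r = base M"
    using k m funpow_image_subset[OF f_points] by (auto simp: r_def V_def)
  have reach: "\<exists>n. (f ^^ n) x \<in> {r}" if "x \<in> V" for x
    unfolding f_def using r that
    by (intro indecomposable_all_reach[OF M ind]) (auto simp: V_def f_def)
  have step: "f x \<in> V" if x: "x \<in> V" "x \<noteq> r" for x
  proof -
    obtain n where n: "(f ^^ n) x = r" using reach[OF x(1)] by blast
    then obtain k where "n = Suc k" using x(2) by (cases n) auto
    then have "f x \<noteq> base M" using n r f_base[of k] by (auto simp: funpow_swap1 V_def)
    then show ?thesis using x f_points by (auto simp: V_def)
  qed
  have "{x \<in> V. f x \<noteq> base M} = V - {r}" using step r by (auto simp: V_def)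
  then have "module_graph M = map_graph V (V - {r}) f"
    by (simp add: module_graph_eq_map_graph V_def f_def)
  moreover have "rooted_tree (map_graph V (V - {r}) f) r"
  proof (rule rooted_tree_map_graph)
    fix x assume x: "x \<in> V" "x \<noteq> r"
    then obtain n where "(f ^^ n) x \<in> {r}" using reach by blast
    then show "f x \<in> V \<and> hitting_time f {r} (f x) < hitting_time f {r} x"
      using step x hitting_time_step[of n f x "{r}"] by simp
  qed (rule r)
  ultimately show ?thesis by metis
qed

text \<open>The cycle is the orbit of a periodic vertex. Since every vertex ends up on it and the base point
  is fixed, no vertex is mapped to the base point, so each vertex has an outgoing arc.\<close>

lemma non_nilpotent_indecomposable_cycle_with_trees:
  assumes M: "tmodule M" and fin: "finite (points M)" and ind: "indecomposable M"
    and non_nil: "\<not> nilpotent M"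
  shows "\<exists>\<sigma>. oriented_cycle_of \<sigma> (module_graph M) \<and>
           (\<forall>\<sigma>'. oriented_cycle_of \<sigma>' (module_graph M) \<longrightarrow> \<sigma>' = \<sigma>) \<and>
           attaching_trees (module_graph M) \<sigma>"
proof -
  define f where "f = act M gen"
  define V where "V = points M - {base M}"
  have f_base: "(f ^^ n) (base M) = base M" for n
    by (induction n) (simp_all add: f_def act_base[OF M])
  have f_points: "f ` points M \<subseteq> points M" using M by (auto simp: f_def tmodule_def)
  obtain m where m: "m \<in> points M" "\<And>n. (f ^^ n) m \<noteq> base M"
    using nilpotentI_funpow[OF M fin] non_nil unfolding f_def by blast
  have "(f ^^ n) m \<in> V" for n
    using m funpow_image_subset[OF f_points] by (auto simp: V_def)
  then obtain c where c: "c \<in> V" "c \<in> orbit f c"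
    using recurrent_point_exists[of V f m] fin by (auto simp: V_def)
  define C where "C = orbit f c"
  have f_C: "f ` C \<subseteq> C" by (auto simp: C_def intro: orbit.step)
  have C_V: "C \<subseteq> V"
  proof
    fix x assume x: "x \<in> C"
    then have "c \<in> orbit f x" using c(2) by (auto simp: C_def intro: orbit_swap)
    then have "x \<noteq> base M" using c(1) f_base by (auto simp: orbit_altdef V_def)
    moreover have "x \<in> points M"
      using x c(1) funpow_image_subset[OF f_points] by (auto simp: C_def orbit_altdef V_def)
    ultimately show "x \<in> V" by (simp add: V_def)
  qed
  have reach: "\<exists>n. (f ^^ n) x \<in> C" if "x \<in> V" for x
    unfolding f_def using C_V f_C that c(2)
    by (intro indecomposable_all_reach[OF M ind]) (auto simp: V_def f_def C_def)
  have f_V: "f ` V \<subseteq> V"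
  proof
    fix y assume "y \<in> f ` V"
    then obtain x where x: "x \<in> V" "y = f x" by blast
    obtain n where "(f ^^ n) x \<in> C" using reach[OF x(1)] by blast
    then have "(f ^^ n) (f x) \<in> C" using f_C by (auto simp: funpow_swap1[symmetric])
    then have "f x \<noteq> base M" using C_V f_base by (auto simp: V_def)
    then show "y \<in> V" using x f_points by (auto simp: V_def)
  qed
  have "{x \<in> V. f x \<noteq> base M} = V" using f_V by (auto simp: V_def)
  then have G: "module_graph M = map_graph V V f"
    by (simp add: module_graph_eq_map_graph V_def f_def)
  have "subgraph (with_proj (map_graph C C f)) (with_proj (map_graph V V f))"
    using C_V f_C f_V
    by (intro subgraphI) (auto simp: wf_digraph_wp_iff intro!: pair_wf_map_graph)
  then have "oriented_cycle_of (map_graph C C f) (map_graph V V f)"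
    using oriented_cycle_map_graph_orbit[OF c(2)] by (simp add: oriented_cycle_of_def C_def)
  moreover have "\<sigma>' = map_graph C C f" if cyc: "oriented_cycle_of \<sigma>' (map_graph V V f)" for \<sigma>'
    using cyc
  proof (rule oriented_cycle_of_map_graphE)
    fix P assume P: "\<sigma>' = map_graph P P f" "P \<subseteq> V" "finite P" "P \<noteq> {}" "f ` P = P"
    have "P = C"
      unfolding C_def using P reach by (intro invariant_set_eq_attracting_orbit[OF c(2)]) (auto simp: C_def)
    then show ?thesis using P(1) by simp
  qed
  moreover have "attaching_trees (map_graph V V f) (map_graph C C f)"
    using C_V f_V reach by (rule attaching_trees_map_graph)
  ultimately show ?thesis unfolding G by blast
qed

theorem proposition2:
  fixes M :: "'a tmod"
  assumes "tmodule M" and "finite (points M)" and "indecomposable M"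
  shows "(nilpotent M \<longrightarrow> (\<exists>r. rooted_tree (module_graph M) r)) \<and>
         (\<not> nilpotent M \<longrightarrow>
            (\<exists>\<sigma>. oriented_cycle_of \<sigma> (module_graph M) \<and>
                 (\<forall>\<sigma>'. oriented_cycle_of \<sigma>' (module_graph M) \<longrightarrow> \<sigma>' = \<sigma>) \<and>
                 attaching_trees (module_graph M) \<sigma>))"
  using nilpotent_indecomposable_rooted_tree[OF assms(1,3)]
    non_nilpotent_indecomposable_cycle_with_trees[OF assms]
  by blast

end
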